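(* Let $d\ge 1$, $\rho>-2$, let $\varepsilon>0$ be fixed and small, and let $v$, $D$, $L_0$ be as in the context. For each $L\ge L_0$ let $I_L\subset[1,\infty)$ and let $(h_z)_{z\in I_L}$ be a family of $\mathbb{Z}^d$-symmetric functions $h_z:\mathbb{Z}^d\to\mathbb{R}$ (which may depend on $L$). Suppose there are a constant $K_h$, independent of $z$ and $L$, and a function $\omega(L)\ge 0$ with $\omega(L)\to0$ as $L\to\infty$, such that for all $L\ge L_0$, $z\in I_L$, $x\in\mathbb{Z}^d$, $$|h_z(x)-\delta_{0,x}|\le K_hL^{-2+\varepsilon}\Big(\delta_{0,x}+\frac{\omega(L)}{|\!|\!|x|\!|\!|^{d+2+\rho}}\Big).$$ Then there is an $L_1$ (depending on $K_h$, $\varepsilon$ and $\omega$), a constant $K_\Phi$ independent of $z$ and $L$, and a function $\tilde\omega(L)\ge 0$ with $\tilde\omega(L)\to0$ as $L\to\infty$, such that for all $L\ge L_1$ and all $z\in I_L$ there exists a $\mathbb{Z}^d$-symmetric function $\Phi_z:\mathbb{Z}^d\to\mathbb{R}$ with $$|\Phi_z(x)|\le K_\Phi L^{-2+\varepsilon}\Big(\delta_{0,x}+\frac{\tilde\omega(L)}{|\!|\!|x|\!|\!|^{d+2+\rho}}\Big)\qquad(x\in\mathbb{Z}^d)$$ such that every bounded $G_z:\mathbb{Z}^d\to\mathbb{R}$ obeying $G_z=h_z+zD*h_z*G_z$ satisfies $$F_z*G_z=\delta,\qquad F_z=\delta-zD-\Phi_z .$$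
   Context: Notation: $|x|$ is the Euclidean norm, $|\!|\!|x|\!|\!|=\max\{|x|,1\}$, $\delta(x)=\delta_{0,x}$ is the Kronecker delta, $(f*g)(x)=\sum_{y\in\mathbb{Z}^d}f(x-y)g(y)$. A function is $\mathbb{Z}^d$-symmetric if it is invariant under reflection in coordinate hyperplanes and rotation by $\pi/2$. "Small" for $\varepsilon$ means $\varepsilon\in(0,2)$, so that $L^{-2+\varepsilon}\to0$. All constants may depend on $d$, $v$, $\rho$, which are fixed. Definition of $D$: let $v:\mathbb{R}^d\to[0,\infty)$ be bounded, $\mathbb{Z}^d$-symmetric, supported in $[-1,1]^d$, with $\frac{\partial^d v}{\partial x_1\cdots\partial x_d}$ piecewise continuous and $\int_{[-1,1]^d}v(x)\,dx=1$. For $L\ge L_0$, $D:\mathbb{Z}^d\to[0,1]$ is $D(x)=v(x/L)/\sum_{y\in\mathbb{Z}^d}v(y/L)$; $L_0\ge1$ is large enough (depending only on $d,v$) that the denominator is nonzero. *)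

theory Defs
  imports "HOL-Analysis.Analysis"
begin

text \<open>\<open>\<real>\<^sup>d\<close> and \<open>\<int>\<^sup>d\<close> are rendered as \<open>real ^ 'n\<close> and \<open>int ^ 'n\<close>, with \<open>d = CARD('n)\<close>.\<close>

subsection \<open>Symmetry\<close>

definition reflect :: "'n \<Rightarrow> 'a::uminus ^ 'n \<Rightarrow> 'a ^ 'n" where
  "reflect i x = (\<chi> k. if k = i then - x $ k else x $ k)"

text \<open>Rotation by \<open>\<pi>/2\<close> in the plane of the \<open>i\<close>-th and \<open>j\<close>-th coordinates, for \<open>i \<noteq> j\<close>.\<close>

definition quarter_turn :: "'n \<Rightarrow> 'n \<Rightarrow> 'a::uminus ^ 'n \<Rightarrow> 'a ^ 'n" where
  "quarter_turn i j x = (\<chi> k. if k = i then - x $ j else if k = j then x $ i else x $ k)"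

definition Zd_symmetric :: "('a::uminus ^ 'n \<Rightarrow> 'b) \<Rightarrow> bool" where
  "Zd_symmetric f \<longleftrightarrow>
     (\<forall>i x. f (reflect i x) = f x) \<and> (\<forall>i j x. i \<noteq> j \<longrightarrow> f (quarter_turn i j x) = f x)"

subsection \<open>Functions on the lattice\<close>

definition embed :: "int ^ 'n \<Rightarrow> real ^ 'n" where
  "embed x = (\<chi> i. real_of_int (x $ i))"

definition tnorm :: "int ^ 'n \<Rightarrow> real" where
  "tnorm x = max (norm (embed x)) 1"

definition delta :: "int ^ 'n \<Rightarrow> real" where
  "delta x = (if x = 0 then 1 else 0)"

text \<open>\<open>infsum\<close> is \<open>0\<close> on families that are not summable. This default plays no role for the
  convolutions below: each has one absolutely summable and one bounded factor.\<close>

definition conv :: "(int ^ 'n \<Rightarrow> real) \<Rightarrow> (int ^ 'n \<Rightarrow> real) \<Rightarrow> int ^ 'n \<Rightarrow> real" where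
  "conv f g x = (\<Sum>\<^sub>\<infinity>y\<in>UNIV. f (x - y) * g y)"

subsection \<open>The spread-out kernel\<close>

text \<open>\<open>has_iterated_partial_on [i\<^sub>1, \<dots>, i\<^sub>m] v U g\<close>: on \<open>U\<close>, the iterated partial derivative
  \<open>\<partial>/\<partial>x\<^bsub>i\<^sub>1\<^esub> (\<dots> (\<partial>v/\<partial>x\<^bsub>i\<^sub>m\<^esub>))\<close> exists and equals \<open>g\<close>. It is meant for open \<open>U\<close>, where the values
  of the intermediate derivatives outside \<open>U\<close> are immaterial.\<close>

primrec has_iterated_partial_on ::
    "'n list \<Rightarrow> (real ^ 'n \<Rightarrow> real) \<Rightarrow> (real ^ 'n) set \<Rightarrow> (real ^ 'n \<Rightarrow> real) \<Rightarrow> bool" where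
  "has_iterated_partial_on [] v U g \<longleftrightarrow> (\<forall>x\<in>U. g x = v x)"
| "has_iterated_partial_on (i # is) v U g \<longleftrightarrow>
     (\<exists>f. has_iterated_partial_on is v U f \<and>
          (\<forall>x\<in>U. ((\<lambda>t. f (x + t *\<^sub>R axis i 1)) has_real_derivative g x) (at 0)))"

text \<open>\<open>\<partial>\<^sup>d v / \<partial>x\<^sub>1 \<dots> \<partial>x\<^sub>d\<close> is piecewise continuous: the space is covered by the closures of finitely
  many open pieces with negligible boundaries, such that on each piece the derivative exists and
  extends continuously to the closure of the piece. The derivative need not exist on the boundaries,
  so that for instance the normalised indicator function of \<open>[-1,1]\<^sup>d\<close> is allowed. The index type
  carries no order; the choice of the order of differentiation is irrelevant for
  \<open>Zd_symmetric\<close> functions, since they are invariant under permutations of the coordinates.\<close>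

definition piecewise_continuous_mixed_partial :: "(real ^ 'n \<Rightarrow> real) \<Rightarrow> bool" where
  "piecewise_continuous_mixed_partial v \<longleftrightarrow>
     (\<exists>is P. distinct is \<and> set is = (UNIV :: 'n set) \<and>
        finite P \<and> (\<Union>U\<in>P. closure U) = UNIV \<and>
        (\<forall>U\<in>P. open U \<and> negligible (frontier U) \<and>
           (\<exists>g. continuous_on (closure U) g \<and> has_iterated_partial_on is v U g)))"

definition spread_out_profile :: "(real ^ 'n \<Rightarrow> real) \<Rightarrow> bool" where
  "spread_out_profile v \<longleftrightarrow>
     (\<forall>x. 0 \<le> v x) \<and> bounded (range v) \<and> Zd_symmetric v \<and>
     (\<forall>x. x \<notin> cbox (- 1) 1 \<longrightarrow> v x = 0) \<and>
     piecewise_continuous_mixed_partial v \<and>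
     (v has_integral 1) (cbox (- 1) 1)"

definition D_norm :: "(real ^ 'n \<Rightarrow> real) \<Rightarrow> real \<Rightarrow> real" where
  "D_norm v L = (\<Sum>\<^sub>\<infinity>y\<in>UNIV. v (embed y /\<^sub>R L))"

definition D :: "(real ^ 'n \<Rightarrow> real) \<Rightarrow> real \<Rightarrow> int ^ 'n \<Rightarrow> real" where
  "D v L x = v (embed x /\<^sub>R L) / D_norm v L"

end

theory Submission
  imports Defs
begin

text \<open>
  Since \<open>h\<close> is close to \<open>\<delta>\<close>, it has a convolution inverse \<open>u = \<delta> - \<Phi>\<close> with \<open>\<Phi>\<close> of the size of
  \<open>e = h - \<delta>\<close>. Convolving \<open>G = h + zD * h * G\<close> with \<open>u\<close> cancels \<open>h\<close> in both terms and leaves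
  \<open>u * G = \<delta> + zD * G\<close>, which is the claim (\<open>resolvent_of_inverse\<close>). Cancelling is legitimate because
  \<open>u\<close>, \<open>h\<close> and \<open>D\<close> are summable and \<open>G\<close> is bounded, so that all convolutions are associative
  (\<open>conv_assoc\<close>).

  The inverse comes from the Neumann series \<open>\<Phi> = e - e * e + e * e * e - \<dots>\<close>, and the point is that it
  inherits the pointwise bound on \<open>e\<close>, a multiple \<open>\<eta>\<close> of the weight
  \<open>w x = \<delta> x + \<omega> L / |||x|||\<^sup>a\<close>, where \<open>a = d + 2 + \<rho>\<close> and \<open>\<eta> = O(L powr (-2 + \<epsilon>))\<close>. This works as soon
  as \<open>w * w \<le> B w\<close> for a constant \<open>B\<close>: the term with \<open>n + 1\<close> factors is then at most
  \<open>\<eta> (\<eta> B)\<^sup>n w\<close>, and for large \<open>L\<close> these bounds sum to \<open>2 \<eta> w\<close> (\<open>neumann_inverse\<close>). In particular \<open>\<Phi>\<close> is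
  controlled with the same \<open>\<omega>\<close> as \<open>e\<close>, and the constant only doubles.

  The stability \<open>w * w \<le> B w\<close>, with \<open>B\<close> uniform in \<open>\<omega> L \<le> 1\<close>, reduces to that of
  \<open>\<tau> x = |||x|||\<^sup>-\<^sup>a\<close> (\<open>conv_weight_bound\<close>). Since \<open>\<rho> > -2\<close> means \<open>a > d\<close>, the function \<open>\<tau>\<close> is summable, and
  among \<open>y\<close> and \<open>x - y\<close> one has at least half the length of \<open>x\<close>; in \<open>\<tau> (x - y) \<tau> y\<close> that factor is
  bounded by a constant times \<open>\<tau> x\<close> and the other one is summed (\<open>conv_tnorm_powr_bound\<close>).
\<close>

section \<open>Convolution of summable and bounded functions\<close>

lemma summable_on_dominated:
  fixes f g :: "'a \<Rightarrow> real"
  assumes "g summable_on A" and "\<And>x. x \<in> A \<Longrightarrow> \<bar>f x\<bar> \<le> g x"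
  shows "f summable_on A"
proof -
  have "(\<lambda>x. \<bar>f x\<bar>) summable_on A"
    by (rule summable_on_comparison_test[OF assms(1)]) (use assms(2) in auto)
  then show ?thesis
    by (simp add: summable_on_iff_abs_summable_on_real[of f])
qed

lemma bij_reflect_point: "bij_betw (\<lambda>y. x - y) UNIV (UNIV :: 'a::ab_group_add set)"
  by (rule bij_betw_byWitness[where f' = "\<lambda>y. x - y"]) auto

lemma bij_translate: "bij_betw (\<lambda>y. y + x) UNIV (UNIV :: 'a::ab_group_add set)"
  by (rule bij_betw_byWitness[where f' = "\<lambda>y. y - x"]) auto

text \<open>The substitution \<open>y \<mapsto> x - y\<close> permutes the lattice, and \<open>infsum\<close> respects
  permutations also where it takes its default value.\<close>
lemma conv_swap: "conv f g x = (\<Sum>\<^sub>\<infinity>y\<in>UNIV. f y * g (x - y))"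
  unfolding conv_def
  using infsum_reindex_bij_betw[OF bij_reflect_point[of x], of "\<lambda>y. f y * g (x - y)"] by simp

lemma conv_commute: "conv f g = conv g f"
proof
  fix x
  show "conv f g x = conv g f x"
    unfolding conv_swap[of f g x] conv_def[of g f] by (simp add: mult.commute)
qed

lemma summable_on_imp_bounded:
  fixes f :: "'a \<Rightarrow> real"
  assumes "f summable_on UNIV"
  shows "bounded (range f)"
proof -
  have s: "(\<lambda>x. \<bar>f x\<bar>) summable_on UNIV"
    using assms by (simp add: summable_on_iff_abs_summable_on_real[of f])
  have "\<bar>f x\<bar> \<le> (\<Sum>\<^sub>\<infinity>y\<in>UNIV. \<bar>f y\<bar>)" for x
    using finite_sum_le_infsum[OF s, of "{x}"] by simp
  then show ?thesis
    unfolding bounded_iff by auto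
qed

lemma summable_conv_terms:
  fixes f g :: "int ^ 'n \<Rightarrow> real"
  assumes f: "f summable_on UNIV" and g: "bounded (range g)"
  shows "(\<lambda>y. f (x - y) * g y) summable_on UNIV"
proof -
  obtain M where M: "\<And>y. \<bar>g y\<bar> \<le> M"
    using g unfolding bounded_iff by auto
  have fa: "(\<lambda>y. \<bar>f y\<bar>) summable_on UNIV"
    using f by (simp add: summable_on_iff_abs_summable_on_real[of f])
  have "(\<lambda>y. \<bar>f (x - y)\<bar>) summable_on UNIV"
    using summable_on_reindex_bij_betw[OF bij_reflect_point[of x], of "\<lambda>y. \<bar>f y\<bar>"] fa
    by blast
  from summable_on_cmult_left[OF this, of M] show ?thesis
  proof (rule summable_on_dominated)
    show "\<bar>f (x - y) * g y\<bar> \<le> \<bar>f (x - y)\<bar> * M" for y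
      unfolding abs_mult by (rule mult_left_mono[OF M]) simp
  qed
qed

lemma conv_left_add:
  assumes "f summable_on UNIV" "f' summable_on UNIV" "bounded (range g)"
  shows "conv (\<lambda>y. f y + f' y) g x = conv f g x + conv f' g x"
  unfolding conv_def distrib_right
  by (rule infsum_add[OF summable_conv_terms[OF assms(1,3)] summable_conv_terms[OF assms(2,3)]])

lemma conv_left_cmult: "conv (\<lambda>y. c * f y) g x = c * conv f g x"
  unfolding conv_def by (simp add: mult.assoc infsum_cmult_right')

lemma conv_left_diff:
  assumes f: "f summable_on UNIV" and f': "f' summable_on UNIV" and g: "bounded (range g)"
  shows "conv (\<lambda>y. f y - f' y) g x = conv f g x - conv f' g x"
  using conv_left_add[OF f summable_on_cmult_right[OF f', of "-1"] g, of x]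
    conv_left_cmult[of "-1" f' g x]
  by simp

lemma conv_delta_left: "conv delta g = g"
proof
  fix x
  have "conv delta g x = (\<Sum>\<^sub>\<infinity>y\<in>{0}. delta y * g (x - y))"
    unfolding conv_swap by (rule infsum_cong_neutral) (auto simp: delta_def)
  then show "conv delta g x = g x"
    by (simp add: delta_def)
qed

lemma summable_delta: "(delta :: int ^ 'n \<Rightarrow> real) summable_on UNIV"
proof -
  have "(delta :: int ^ 'n \<Rightarrow> real) summable_on UNIV \<longleftrightarrow> (delta :: int ^ 'n \<Rightarrow> real) summable_on {0}"
    by (rule summable_on_cong_neutral) (auto simp: delta_def)
  then show ?thesis
    by simp
qed

text \<open>Absolute summability of the double family behind \<open>f * g\<close>: this is what Fubini needs both for
  \<open>\<ell>\<^sup>1 * \<ell>\<^sup>1 \<subseteq> \<ell>\<^sup>1\<close> and for associativity.\<close>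
lemma summable_conv_pair:
  fixes f g :: "int ^ 'n \<Rightarrow> real"
  assumes f: "f summable_on UNIV" and g: "g summable_on UNIV"
  shows "(\<lambda>(y, t). \<bar>f y\<bar> * \<bar>g (t - y)\<bar>) summable_on UNIV \<times> UNIV"
proof (rule summable_on_SigmaI)
  let ?G = "\<Sum>\<^sub>\<infinity>t\<in>UNIV. \<bar>g t\<bar>"
  have ga: "(\<lambda>t. \<bar>g t\<bar>) summable_on UNIV" and fa: "(\<lambda>t. \<bar>f t\<bar>) summable_on UNIV"
    using f g summable_on_iff_abs_summable_on_real[of f] summable_on_iff_abs_summable_on_real[of g]
    by auto
  show "((\<lambda>t. case (y, t) of (y, t) \<Rightarrow> \<bar>f y\<bar> * \<bar>g (t - y)\<bar>) has_sum \<bar>f y\<bar> * ?G) UNIV" for y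
  proof -
    have "((\<lambda>t. \<bar>g (t - y)\<bar>) has_sum ?G) UNIV"
      using has_sum_infsum[OF ga] has_sum_reindex_bij_betw[OF bij_translate[of "-y"], of "\<lambda>t. \<bar>g t\<bar>" ?G]
      by simp
    from has_sum_cmult_right[OF this, of "\<bar>f y\<bar>"] show ?thesis by simp
  qed
  show "(\<lambda>y. \<bar>f y\<bar> * ?G) summable_on UNIV"
    by (rule summable_on_cmult_left[OF fa])
qed auto

lemma summable_conv:
  fixes f g :: "int ^ 'n \<Rightarrow> real"
  assumes f: "f summable_on UNIV" and g: "g summable_on UNIV"
  shows "conv f g summable_on UNIV"
proof -
  have "(\<lambda>(y, t). f y * g (t - y)) summable_on UNIV \<times> UNIV"
    by (rule summable_on_dominated[OF summable_conv_pair[OF f g]]) (auto simp: abs_mult)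
  then have "(\<lambda>(t, y). f y * g (t - y)) summable_on UNIV \<times> UNIV"
    by (subst (asm) summable_on_swap) simp
  then have "(\<lambda>t. \<Sum>\<^sub>\<infinity>y\<in>UNIV. f y * g (t - y)) summable_on UNIV"
    by (rule summable_on_Sigma_banach)
  then show ?thesis
    by (simp add: conv_swap[abs_def])
qed

text \<open>A bounded third factor preserves the absolute summability of the double sum, so the order of
  summation can be exchanged although \<open>k\<close> is merely bounded.\<close>
lemma conv_assoc:
  fixes f g k :: "int ^ 'n \<Rightarrow> real"
  assumes f: "f summable_on UNIV" and g: "g summable_on UNIV" and k: "bounded (range k)"
  shows "conv (conv f g) k = conv f (conv g k)"
proof
  fix x
  obtain M where M: "\<And>y. \<bar>k y\<bar> \<le> M"
    using k unfolding bounded_iff by auto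
  let ?F = "\<lambda>y t. f y * g (t - y) * k (x - t)"
  have "(\<lambda>p. (case p of (y, t) \<Rightarrow> \<bar>f y\<bar> * \<bar>g (t - y)\<bar>) * M) summable_on UNIV \<times> UNIV"
    by (rule summable_on_cmult_left[OF summable_conv_pair[OF f g]])
  then have sum: "(\<lambda>(y, t). ?F y t) summable_on UNIV \<times> UNIV"
    by (rule summable_on_dominated) (auto simp: abs_mult intro!: mult_left_mono M)
  have "conv (conv f g) k x = (\<Sum>\<^sub>\<infinity>t\<in>UNIV. \<Sum>\<^sub>\<infinity>y\<in>UNIV. ?F y t)"
    by (simp add: conv_swap infsum_cmult_left')
  also have "\<dots> = (\<Sum>\<^sub>\<infinity>y\<in>UNIV. \<Sum>\<^sub>\<infinity>t\<in>UNIV. ?F y t)"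
    by (rule infsum_swap_banach[OF sum, symmetric])
  also have "\<dots> = (\<Sum>\<^sub>\<infinity>y\<in>UNIV. f y * conv g k (x - y))"
  proof (rule infsum_cong)
    fix y
    have "(\<Sum>\<^sub>\<infinity>t\<in>UNIV. ?F y t) = (\<Sum>\<^sub>\<infinity>w\<in>UNIV. ?F y (w + y))"
      using infsum_reindex_bij_betw[OF bij_translate[of y], of "?F y"] by simp
    also have "\<dots> = (\<Sum>\<^sub>\<infinity>w\<in>UNIV. f y * (g w * k (x - y - w)))"
      by (simp add: algebra_simps)
    also have "\<dots> = f y * conv g k (x - y)"
      by (simp add: conv_swap infsum_cmult_right')
    finally show "(\<Sum>\<^sub>\<infinity>t\<in>UNIV. ?F y t) = f y * conv g k (x - y)" .
  qed
  also have "\<dots> = conv f (conv g k) x"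
    by (simp add: conv_swap)
  finally show "conv (conv f g) k x = conv f (conv g k) x" .
qed

lemma bounded_conv:
  fixes f g :: "int ^ 'n \<Rightarrow> real"
  assumes f: "f summable_on UNIV" and g: "bounded (range g)"
  shows "bounded (range (conv f g))"
proof -
  obtain M where M: "\<And>y. \<bar>g y\<bar> \<le> M"
    using g unfolding bounded_iff by auto
  have fa: "(\<lambda>y. \<bar>f y\<bar>) summable_on UNIV"
    using f by (simp add: summable_on_iff_abs_summable_on_real[of f])
  have dom: "\<bar>f y * g (x - y)\<bar> \<le> \<bar>f y\<bar> * M" for x y
    by (auto simp: abs_mult intro!: mult_left_mono M)
  have "\<bar>conv f g x\<bar> \<le> (\<Sum>\<^sub>\<infinity>y\<in>UNIV. \<bar>f y\<bar> * M)" for x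
  proof -
    have s: "(\<lambda>y. \<bar>f y * g (x - y)\<bar>) summable_on UNIV"
      by (rule summable_on_comparison_test[OF summable_on_cmult_left[OF fa]]) (use dom in auto)
    have "\<bar>conv f g x\<bar> \<le> (\<Sum>\<^sub>\<infinity>y\<in>UNIV. \<bar>f y * g (x - y)\<bar>)"
      unfolding conv_swap using norm_infsum_bound[of "\<lambda>y. f y * g (x - y)" UNIV] s by simp
    also have "\<dots> \<le> (\<Sum>\<^sub>\<infinity>y\<in>UNIV. \<bar>f y\<bar> * M)"
      by (rule infsum_mono[OF s summable_on_cmult_left[OF fa]]) (use dom in auto)
    finally show ?thesis .
  qed
  then show ?thesis
    unfolding bounded_iff by auto
qed

section \<open>Symmetry under convolution\<close>

text \<open>An additive bijection of the lattice permutes the terms of the convolution sum.\<close>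
lemma conv_invariant:
  assumes bij: "bij R" and diff: "\<And>x y. R (x - y) = R x - R y"
    and f: "\<And>x. f (R x) = f x" and g: "\<And>x. g (R x) = g x"
  shows "conv f g (R x) = conv f g x"
proof -
  have "conv f g (R x) = (\<Sum>\<^sub>\<infinity>y\<in>UNIV. f (R x - R y) * g (R y))"
    unfolding conv_def
    using infsum_reindex_bij_betw[OF bij, of "\<lambda>y. f (R x - y) * g y"] by simp
  also have "\<dots> = conv f g x"
    by (simp add: conv_def f g flip: diff)
  finally show ?thesis .
qed

lemma Zd_symmetric_conv:
  fixes f g :: "int ^ 'n \<Rightarrow> real"
  assumes "Zd_symmetric f" "Zd_symmetric g"
  shows "Zd_symmetric (conv f g)"
  unfolding Zd_symmetric_def
proof (intro conjI allI impI)
  fix i :: 'n and x :: "int ^ 'n"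
  have "bij (reflect i :: int ^ 'n \<Rightarrow> int ^ 'n)"
    by (rule bij_betw_byWitness[where f' = "reflect i"]) (auto simp: reflect_def vec_eq_iff)
  then show "conv f g (reflect i x) = conv f g x"
    by (rule conv_invariant)
      (use assms in \<open>auto simp: Zd_symmetric_def\<close>, auto simp: reflect_def vec_eq_iff)
next
  fix i j :: 'n and x :: "int ^ 'n"
  assume ij: "i \<noteq> j"
  have "bij (quarter_turn i j :: int ^ 'n \<Rightarrow> int ^ 'n)"
    by (rule bij_betw_byWitness[where f' = "quarter_turn j i"])
      (use ij in \<open>auto simp: quarter_turn_def vec_eq_iff\<close>)
  then show "conv f g (quarter_turn i j x) = conv f g x"
    by (rule conv_invariant)
      (use assms ij in \<open>auto simp: Zd_symmetric_def\<close>, auto simp: quarter_turn_def vec_eq_iff)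
qed

lemma Zd_symmetric_delta: "Zd_symmetric (delta :: int ^ 'n \<Rightarrow> real)"
proof -
  have "reflect i x = 0 \<longleftrightarrow> x = 0" for i and x :: "int ^ 'n"
    by (auto simp: reflect_def vec_eq_iff)
  moreover have "quarter_turn i j x = 0 \<longleftrightarrow> x = 0" if "i \<noteq> j" for i j and x :: "int ^ 'n"
  proof
    assume 0: "quarter_turn i j x = 0"
    have "x $ k = 0" for k
      using arg_cong[OF 0, of "\<lambda>y. y $ i"] arg_cong[OF 0, of "\<lambda>y. y $ j"]
        arg_cong[OF 0, of "\<lambda>y. y $ k"] that
      by (cases "k = i"; cases "k = j") (simp_all add: quarter_turn_def)
    then show "x = 0"
      by (simp add: vec_eq_iff)
  qed (simp add: quarter_turn_def vec_eq_iff)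
  ultimately show ?thesis
    by (auto simp: Zd_symmetric_def delta_def)
qed

section \<open>Inversion by a Neumann series in a convolution-stable class\<close>

text \<open>The class of functions dominated by a multiple of \<open>w\<close> is closed under convolution when
  \<open>w * w \<le> B w\<close>, and the constants multiply up to the factor \<open>B\<close>.\<close>
lemma conv_bound:
  fixes f g w :: "int ^ 'n \<Rightarrow> real"
  assumes w0: "\<And>x. 0 \<le> w x" and w: "w summable_on UNIV"
    and stable: "\<And>x. conv w w x \<le> B * w x"
    and a: "0 \<le> a" and f: "\<And>x. \<bar>f x\<bar> \<le> a * w x"
    and b: "0 \<le> b" and g: "\<And>x. \<bar>g x\<bar> \<le> b * w x"
  shows "\<bar>conv f g x\<bar> \<le> a * b * B * w x"
proof -
  have dom: "\<bar>f (x - y) * g y\<bar> \<le> a * b * (w (x - y) * w y)" for y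
  proof -
    have "\<bar>f (x - y)\<bar> * \<bar>g y\<bar> \<le> (a * w (x - y)) * (b * w y)"
      by (intro mult_mono f g mult_nonneg_nonneg a w0) auto
    then show ?thesis by (simp add: abs_mult mult_ac)
  qed
  have ws: "(\<lambda>y. a * b * (w (x - y) * w y)) summable_on UNIV"
    by (intro summable_on_cmult_right summable_conv_terms w summable_on_imp_bounded)
  have s: "(\<lambda>y. \<bar>f (x - y) * g y\<bar>) summable_on UNIV"
    by (rule summable_on_comparison_test[OF ws]) (use dom in auto)
  have "\<bar>conv f g x\<bar> \<le> (\<Sum>\<^sub>\<infinity>y\<in>UNIV. \<bar>f (x - y) * g y\<bar>)"
    unfolding conv_def using norm_infsum_bound[of "\<lambda>y. f (x - y) * g y" UNIV] s by simp
  also have "\<dots> \<le> (\<Sum>\<^sub>\<infinity>y\<in>UNIV. a * b * (w (x - y) * w y))"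
    by (rule infsum_mono[OF s ws]) (use dom in auto)
  also have "\<dots> = a * b * conv w w x"
    by (simp add: conv_def infsum_cmult_right')
  also have "\<dots> \<le> a * b * (B * w x)"
    by (intro mult_left_mono stable mult_nonneg_nonneg a b)
  finally show ?thesis
    by (simp add: mult_ac)
qed

text \<open>The series solves \<open>\<Phi> = e - e * \<Phi>\<close>, which is the equation \<open>(\<delta> + e) * (\<delta> - \<Phi>) = \<delta>\<close>; hence the
  alternating signs and the start at \<open>e\<close> rather than at \<open>\<delta>\<close>.\<close>
primrec neumann_term :: "(int ^ 'n \<Rightarrow> real) \<Rightarrow> nat \<Rightarrow> int ^ 'n \<Rightarrow> real" where
  "neumann_term e 0 = e"
| "neumann_term e (Suc n) = (\<lambda>x. - conv e (neumann_term e n) x)"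

lemma Zd_symmetric_neumann_term:
  assumes "Zd_symmetric e"
  shows "Zd_symmetric (neumann_term e n)"
proof (induction n)
  case (Suc n)
  from Zd_symmetric_conv[OF assms Suc] show ?case
    by (simp add: Zd_symmetric_def)
qed (use assms in simp)

text \<open>The terms decay geometrically relative to \<open>w\<close>, since each further convolution with \<open>e\<close> costs a
  factor \<open>\<eta> B \<le> 1/2\<close>. The partial sums telescope to an approximate solution of \<open>\<Phi> + \<Phi> * e = e\<close>, and
  the geometric bound on the tail, once more convolved with \<open>e\<close>, lets the error tend to \<open>0\<close>. This
  avoids any exchange of the series with the convolution sum.\<close>
lemma neumann_inverse:
  fixes e w :: "int ^ 'n \<Rightarrow> real"
  assumes w0: "\<And>x. 0 \<le> w x" and w: "w summable_on UNIV"
    and stable: "\<And>x. conv w w x \<le> B * w x"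
    and \<eta>: "0 \<le> \<eta>" "\<eta> * B \<le> 1 / 2" and B: "0 \<le> B"
    and e: "\<And>x. \<bar>e x\<bar> \<le> \<eta> * w x" and sym: "Zd_symmetric e"
  obtains \<Phi> where "Zd_symmetric \<Phi>" and "\<And>x. \<bar>\<Phi> x\<bar> \<le> 2 * \<eta> * w x"
    and "conv (\<lambda>y. delta y - \<Phi> y) (\<lambda>y. delta y + e y) = delta"
proof -
  define p where "p = neumann_term e"
  have p0: "p 0 = e" and pSuc: "\<And>n. p (Suc n) = (\<lambda>x. - conv e (p n) x)"
    by (simp_all add: p_def)
  have p_bound: "\<bar>p n x\<bar> \<le> \<eta> * (1 / 2) ^ n * w x" for n x
  proof (induction n arbitrary: x)
    case 0
    show ?case using e by (simp add: p0)
  next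
    case (Suc n)
    have "\<bar>conv e (p n) x\<bar> \<le> \<eta> * (\<eta> * (1 / 2) ^ n) * B * w x"
      by (rule conv_bound[OF w0 w stable \<eta>(1) e _ Suc]) (use \<eta> in auto)
    also have "\<dots> = (\<eta> * B) * (\<eta> * (1 / 2) ^ n * w x)"
      by simp
    also have "\<dots> \<le> 1 / 2 * (\<eta> * (1 / 2) ^ n * w x)"
      by (intro mult_right_mono \<eta> mult_nonneg_nonneg w0) (use \<eta> in auto)
    finally show ?case by (simp add: pSuc mult_ac)
  qed
  have geo: "(\<lambda>n. \<eta> * (1 / 2) ^ n * w x) sums (2 * \<eta> * w x)" for x
    using sums_mult[OF geometric_sums[of "1 / 2 :: real"], of "\<eta> * w x"] by (simp add: mult_ac)
  have p_sum: "summable (\<lambda>n. p n x)" for x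
    by (rule summable_comparison_test'[OF sums_summable[OF geo]]) (use p_bound in auto)
  define \<Phi> where "\<Phi> x = (\<Sum>n. p n x)" for x
  define S where "S N x = (\<Sum>n<N. p n x)" for N x

  have tail: "\<bar>\<Phi> x - S N x\<bar> \<le> 2 * \<eta> * (1 / 2) ^ N * w x" for N x
  proof -
    have g: "(\<lambda>n. \<eta> * (1 / 2) ^ (n + N) * w x) sums (2 * \<eta> * (1 / 2) ^ N * w x)"
      using sums_mult[OF geo, of "(1 / 2) ^ N" x] by (simp add: power_add mult_ac)
    have "\<Phi> x - S N x = (\<Sum>n. p (n + N) x)"
      unfolding \<Phi>_def S_def using suminf_split_initial_segment[OF p_sum, of x N] by simp
    also have "norm \<dots> \<le> (\<Sum>n. \<eta> * (1 / 2) ^ (n + N) * w x)"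
      by (rule norm_suminf_le) (use p_bound sums_summable[OF g] in \<open>auto simp: real_norm_def\<close>)
    finally show ?thesis using sums_unique[OF g] by simp
  qed
  have bound: "\<bar>\<Phi> x\<bar> \<le> 2 * \<eta> * w x" for x
    using tail[of x 0] by (simp add: S_def)
  have dominated: "f summable_on UNIV" if "\<And>x. \<bar>f x\<bar> \<le> c * w x" for f c
    by (rule summable_on_dominated[OF summable_on_cmult_right[OF w]]) (use that in auto)
  have es: "e summable_on UNIV" and \<Phi>s: "\<Phi> summable_on UNIV" and ps: "p n summable_on UNIV" for n
    by (rule dominated[OF e] dominated[OF bound] dominated[OF p_bound])+
  have Ss: "S N summable_on UNIV" for N
    unfolding S_def[abs_def] by (induction N) (auto intro: summable_on_add ps)

  have telescope: "S N x + conv (S N) e x = e x - p N x" for N x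
  proof (induction N)
    case 0
    show ?case by (simp add: S_def p0 conv_def)
  next
    case (Suc N)
    have "S (Suc N) = (\<lambda>x. S N x + p N x)"
      by (simp add: S_def fun_eq_iff)
    then have "conv (S (Suc N)) e x = conv (S N) e x + conv (p N) e x"
      by (simp add: conv_left_add[OF Ss ps summable_on_imp_bounded[OF es]])
    moreover have "p (Suc N) x = - conv (p N) e x"
      by (simp add: pSuc conv_commute[of e])
    moreover have "S (Suc N) x = S N x + p N x"
      by (simp add: S_def)
    ultimately show ?case using Suc by simp
  qed
  have fixed_point: "\<Phi> x + conv \<Phi> e x = e x" for x
  proof -
    let ?c = "2 * \<eta> * w x + 2 * \<eta> * \<eta> * B * w x + \<eta> * w x"
    have "\<bar>\<Phi> x + conv \<Phi> e x - e x\<bar> \<le> ?c * (1 / 2) ^ N" for N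
    proof -
      have "conv \<Phi> e x - conv (S N) e x = conv (\<lambda>y. \<Phi> y - S N y) e x"
        by (simp add: conv_left_diff[OF \<Phi>s Ss summable_on_imp_bounded[OF es]])
      also have "\<bar>\<dots>\<bar> \<le> (2 * \<eta> * (1 / 2) ^ N) * \<eta> * B * w x"
        by (rule conv_bound[OF w0 w stable _ tail \<eta>(1) e]) (use \<eta> in auto)
      finally have "\<bar>conv \<Phi> e x - conv (S N) e x\<bar> \<le> (2 * \<eta> * (1 / 2) ^ N) * \<eta> * B * w x" .
      with tail[of x N] p_bound[of N x] telescope[of N x]
      have "\<bar>\<Phi> x + conv \<Phi> e x - e x\<bar> \<le> 2 * \<eta> * (1 / 2) ^ N * w x
          + (2 * \<eta> * (1 / 2) ^ N) * \<eta> * B * w x + \<eta> * (1 / 2) ^ N * w x"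
        by linarith
      then show ?thesis by (simp add: algebra_simps)
    qed
    moreover have "(\<lambda>N. ?c * (1 / 2) ^ N) \<longlonglongrightarrow> 0"
      by (intro tendsto_mult_right_zero LIMSEQ_realpow_zero) auto
    ultimately have "\<bar>\<Phi> x + conv \<Phi> e x - e x\<bar> \<le> 0"
      by (intro LIMSEQ_le_const) auto
    then show ?thesis by simp
  qed
  show thesis
  proof (rule that)
    show "Zd_symmetric \<Phi>"
      using Zd_symmetric_neumann_term[OF sym] by (simp add: Zd_symmetric_def \<Phi>_def p_def)
    show "\<bar>\<Phi> x\<bar> \<le> 2 * \<eta> * w x" for x
      by (rule bound)
    show "conv (\<lambda>y. delta y - \<Phi> y) (\<lambda>y. delta y + e y) = delta"
    proof
      fix x
      have h: "bounded (range (\<lambda>y. delta y + e y))"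
        by (intro summable_on_imp_bounded summable_on_add summable_delta es)
      have "conv \<Phi> (\<lambda>y. delta y + e y) x = conv (\<lambda>y. delta y + e y) \<Phi> x"
        by (simp add: conv_commute)
      also have "\<dots> = \<Phi> x + conv \<Phi> e x"
        by (simp add: conv_left_add[OF summable_delta es summable_on_imp_bounded[OF \<Phi>s]]
            conv_delta_left conv_commute[of e])
      finally show "conv (\<lambda>y. delta y - \<Phi> y) (\<lambda>y. delta y + e y) x = delta x"
        using fixed_point[of x]
        by (simp add: conv_left_diff[OF summable_delta \<Phi>s h] conv_delta_left)
    qed
  qed
qed

section \<open>Polynomial decay on the lattice\<close>

lemma tnorm_ge_1: "1 \<le> tnorm x"
  by (simp add: tnorm_def)

lemma tnorm_triangle: "tnorm x \<le> tnorm (x - y) + tnorm y"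
proof -
  have "embed x = embed (x - y) + embed y"
    by (simp add: embed_def vec_eq_iff)
  then have "norm (embed x) \<le> norm (embed (x - y)) + norm (embed y)"
    by (metis norm_triangle_ineq)
  then show ?thesis
    by (auto simp: tnorm_def max_def)
qed

lemma max_coord_le_tnorm: "max 1 \<bar>real_of_int (x $ i)\<bar> \<le> tnorm x"
  using component_le_norm_cart[of "embed x" i] by (simp add: tnorm_def embed_def)

lemma summable_on_int_powr:
  assumes "1 < s"
  shows "(\<lambda>k :: int. max 1 \<bar>real_of_int k\<bar> powr - s) summable_on UNIV"
proof -
  let ?f = "\<lambda>k :: int. max 1 \<bar>real_of_int k\<bar> powr - s"
  have Suc: "summable (\<lambda>n. real (Suc n) powr - s)"
    using summable_real_powr_iff[of "- s"] assms
    by (subst summable_Suc_iff[of "\<lambda>n. real n powr - s"]) simp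
  have f1: "?f (int (Suc n)) = real (Suc n) powr - s" for n
    by (simp add: max_def)
  have "summable (\<lambda>n. ?f (int n))"
    by (subst summable_Suc_iff[symmetric], subst f1) (rule Suc)
  then have "(?f \<circ> int) summable_on UNIV"
    by (subst summable_on_UNIV_nonneg_real_iff) (auto simp: o_def)
  then have pos: "?f summable_on range int"
    by (subst summable_on_reindex) auto
  have "(?f \<circ> (\<lambda>n. - int (Suc n))) summable_on UNIV"
  proof (subst summable_on_UNIV_nonneg_real_iff)
    have "?f (- int (Suc n)) = real (Suc n) powr - s" for n
      by (simp add: max_def add.commute)
    then show "summable (?f \<circ> (\<lambda>n. - int (Suc n)))"
      using Suc by (simp only: o_def)
  qed auto
  then have neg: "?f summable_on range (\<lambda>n. - int (Suc n))"
    by (subst summable_on_reindex) (auto simp: inj_on_def)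
  have "k \<in> range int \<union> range (\<lambda>n. - int (Suc n))" for k
    by (rule int_cases[of k]) blast+
  then have "range int \<union> range (\<lambda>n. - int (Suc n)) = UNIV"
    by blast
  with summable_on_union[OF pos neg] show ?thesis
    by simp
qed

text \<open>A finite set of vectors lies in a finite box \<open>A\<^sup>n\<close>, over which the sum of the products factorises;
  each factor is at most the full sum of \<open>f\<close>.\<close>
lemma summable_on_vec_prod:
  fixes f :: "'a \<Rightarrow> real"
  assumes f0: "\<And>k. 0 \<le> f k" and f: "f summable_on UNIV"
  shows "(\<lambda>x :: 'a ^ 'n. \<Prod>i\<in>UNIV. f (x $ i)) summable_on UNIV"
proof (rule nonneg_bdd_above_summable_on)
  show "bdd_above (sum (\<lambda>x :: 'a ^ 'n. \<Prod>i\<in>UNIV. f (x $ i)) ` {F. F \<subseteq> UNIV \<and> finite F})"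
  proof (rule bdd_aboveI2)
    fix F :: "('a ^ 'n) set"
    assume "F \<in> {F. F \<subseteq> UNIV \<and> finite F}"
    then have F: "finite F" by simp
    define A where "A = (\<lambda>(x, i). x $ i) ` (F \<times> (UNIV :: 'n set))"
    have A: "finite A" unfolding A_def using F by simp
    have sub: "vec_nth ` F \<subseteq> (\<Pi>\<^sub>E i\<in>UNIV. A)"
      by (auto simp: A_def PiE_UNIV_domain image_iff)
    have "(\<Sum>x\<in>F. \<Prod>i\<in>UNIV. f (x $ i)) = (\<Sum>g\<in>vec_nth ` F. \<Prod>i\<in>UNIV. f (g i))"
      by (subst sum.reindex) (auto simp: inj_on_def vec_eq_iff)
    also have "\<dots> \<le> (\<Sum>g\<in>(\<Pi>\<^sub>E i\<in>UNIV. A). \<Prod>i\<in>(UNIV :: 'n set). f (g i))"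
      by (rule sum_mono2[OF finite_PiE sub]) (auto intro: A prod_nonneg f0)
    also have "\<dots> = (\<Prod>i\<in>(UNIV :: 'n set). \<Sum>k\<in>A. f k)"
      by (rule prod_sum_PiE[symmetric]) (auto intro: A)
    also have "\<dots> \<le> (\<Prod>i\<in>(UNIV :: 'n set). infsum f UNIV)"
      by (rule prod_mono) (auto intro!: sum_nonneg f0 finite_sum_le_infsum[OF f A])
    finally show "(\<Sum>x\<in>F. \<Prod>i\<in>UNIV. f (x $ i)) \<le> (\<Prod>i\<in>(UNIV :: 'n set). infsum f UNIV)" .
  qed
qed (auto intro: prod_nonneg f0)

text \<open>Every \<open>max 1 \<bar>x\<^sub>i\<bar>\<close> is at most \<open>|||x|||\<close>, so writing \<open>|||x|||\<^sup>-\<^sup>a\<close> as a product of \<open>d\<close> equal factors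
  with exponent \<open>-a/d\<close> bounds it by a product of functions of one coordinate. These are summable over
  \<open>\<int>\<close> exactly when \<open>a/d > 1\<close>, so the comparison loses nothing in the range of exponents.\<close>
lemma summable_on_tnorm_powr:
  assumes a: "real CARD('n) < a"
  shows "(\<lambda>x :: int ^ 'n. tnorm x powr - a) summable_on UNIV"
proof -
  define s where "s = a / real CARD('n)"
  have s: "1 < s" using a by (simp add: s_def)
  have "(\<lambda>x :: int ^ 'n. \<Prod>i\<in>UNIV. max 1 \<bar>real_of_int (x $ i)\<bar> powr - s) summable_on UNIV"
    by (rule summable_on_vec_prod[OF _ summable_on_int_powr[OF s]]) simp
  then show ?thesis
  proof (rule summable_on_comparison_test)
    fix x :: "int ^ 'n"
    have pos: "0 < tnorm x" using tnorm_ge_1[of x] by linarith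
    have "tnorm x powr - a = (tnorm x powr - s) ^ CARD('n)"
      using pos by (simp add: powr_realpow[symmetric] powr_powr s_def)
    also have "\<dots> = (\<Prod>i\<in>(UNIV :: 'n set). tnorm x powr - s)"
      by simp
    also have "\<dots> \<le> (\<Prod>i\<in>UNIV. max 1 \<bar>real_of_int (x $ i)\<bar> powr - s)"
      by (rule prod_mono) (use s in \<open>auto intro!: powr_mono2' max_coord_le_tnorm\<close>)
    finally show "tnorm x powr - a \<le> (\<Prod>i\<in>UNIV. max 1 \<bar>real_of_int (x $ i)\<bar> powr - s)" .
  qed auto
qed

text \<open>By the triangle inequality, one of \<open>y\<close> and \<open>x - y\<close> has at least half the length of \<open>x\<close>. The
  corresponding factor is at most \<open>2\<^sup>a |||x|||\<^sup>-\<^sup>a\<close>, and the sum over the other factor is finite.\<close>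
lemma conv_tnorm_powr_bound:
  assumes a: "real CARD('n) < a"
  obtains C where "0 \<le> C"
    and "\<And>x :: int ^ 'n. conv (\<lambda>y. tnorm y powr - a) (\<lambda>y. tnorm y powr - a) x \<le> C * tnorm x powr - a"
proof
  let ?\<tau> = "\<lambda>y :: int ^ 'n. tnorm y powr - a"
  let ?S = "infsum ?\<tau> UNIV"
  note \<tau> = summable_on_tnorm_powr[OF a]
  have a0: "0 \<le> a" using a by linarith
  show "0 \<le> 2 powr a * (?S + ?S)"
    by (intro mult_nonneg_nonneg add_nonneg_nonneg infsum_nonneg) auto
  fix x :: "int ^ 'n"
  (* For |||x||| \<le> 2 |||y|||, a negative power reverses the inequality and produces the factor 2^a. *)
  have half: "?\<tau> y \<le> 2 powr a * ?\<tau> x" if "tnorm x \<le> 2 * tnorm y" for y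
  proof -
    have "(2 * tnorm y) powr - a \<le> tnorm x powr - a"
      using that tnorm_ge_1[of x] a0 by (intro powr_mono2') auto
    then have "2 powr a * (2 powr - a * ?\<tau> y) \<le> 2 powr a * ?\<tau> x"
      using tnorm_ge_1[of y] by (intro mult_left_mono) (auto simp: powr_mult)
    then show ?thesis by (simp add: powr_minus field_simps)
  qed
  have split: "?\<tau> (x - y) * ?\<tau> y \<le> 2 powr a * ?\<tau> x * (?\<tau> (x - y) + ?\<tau> y)" for y
  proof -
    consider "tnorm x \<le> 2 * tnorm y" | "tnorm x \<le> 2 * tnorm (x - y)"
      using tnorm_triangle[of x y] by linarith
    then show ?thesis
    proof cases
      case 1
      have "?\<tau> (x - y) * ?\<tau> y \<le> ?\<tau> (x - y) * (2 powr a * ?\<tau> x)"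
        by (rule mult_left_mono[OF half[OF 1]]) simp
      also have "\<dots> \<le> 2 powr a * ?\<tau> x * (?\<tau> (x - y) + ?\<tau> y)"
        by (simp add: algebra_simps)
      finally show ?thesis .
    next
      case 2
      have "?\<tau> (x - y) * ?\<tau> y \<le> (2 powr a * ?\<tau> x) * ?\<tau> y"
        by (rule mult_right_mono[OF half[OF 2]]) simp
      also have "\<dots> \<le> 2 powr a * ?\<tau> x * (?\<tau> (x - y) + ?\<tau> y)"
        by (simp add: algebra_simps)
      finally show ?thesis .
    qed
  qed
  have \<tau>': "(\<lambda>y. ?\<tau> (x - y)) summable_on UNIV"
    using \<tau> summable_on_reindex_bij_betw[OF bij_reflect_point[of x], of ?\<tau>] by simp
  have S': "(\<Sum>\<^sub>\<infinity>y\<in>UNIV. ?\<tau> (x - y)) = ?S"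
    using infsum_reindex_bij_betw[OF bij_reflect_point[of x], of ?\<tau>] by simp
  have "conv ?\<tau> ?\<tau> x \<le> (\<Sum>\<^sub>\<infinity>y\<in>UNIV. 2 powr a * ?\<tau> x * (?\<tau> (x - y) + ?\<tau> y))"
    unfolding conv_def
    by (intro infsum_mono summable_conv_terms \<tau> summable_on_imp_bounded summable_on_cmult_right
        summable_on_add \<tau>' split)
  also have "\<dots> = 2 powr a * (?S + ?S) * ?\<tau> x"
    by (simp add: infsum_cmult_right' infsum_add[OF \<tau>' \<tau>] S')
  finally show "conv ?\<tau> ?\<tau> x \<le> 2 powr a * (?S + ?S) * ?\<tau> x" .
qed

text \<open>Expanding the square gives \<open>\<delta> + 2 c \<tau> + c\<^sup>2 (\<tau> * \<tau>)\<close>. The last term carries one factor \<open>c\<close> too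
  many, which \<open>c \<le> 1\<close> absorbs; this keeps the constant uniform as \<open>c\<close> tends to \<open>0\<close>.\<close>
lemma conv_weight_bound:
  fixes \<tau> :: "int ^ 'n \<Rightarrow> real"
  assumes \<tau>0: "\<And>x. 0 \<le> \<tau> x" and \<tau>: "\<tau> summable_on UNIV"
    and C: "\<And>x. conv \<tau> \<tau> x \<le> C * \<tau> x" and c: "0 \<le> c" "c \<le> 1" and C0: "0 \<le> C"
  shows "conv (\<lambda>y. delta y + c * \<tau> y) (\<lambda>y. delta y + c * \<tau> y) x \<le> (2 + C) * (delta x + c * \<tau> x)"
proof -
  let ?w = "\<lambda>y. delta y + c * \<tau> y"
  have c\<tau>: "(\<lambda>y. c * \<tau> y) summable_on UNIV"
    by (rule summable_on_cmult_right[OF \<tau>])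
  have w: "?w summable_on UNIV"
    by (intro summable_on_add summable_delta c\<tau>)
  have "conv \<tau> ?w x = conv ?w \<tau> x"
    by (simp add: conv_commute)
  also have "\<dots> = \<tau> x + c * conv \<tau> \<tau> x"
    by (simp add: conv_left_add[OF summable_delta c\<tau> summable_on_imp_bounded[OF \<tau>]]
        conv_delta_left conv_left_cmult)
  also have "\<dots> \<le> \<tau> x + 1 * (C * \<tau> x)"
  proof -
    have "0 \<le> conv \<tau> \<tau> x"
      unfolding conv_def by (intro infsum_nonneg mult_nonneg_nonneg \<tau>0)
    then show ?thesis
      by (intro add_left_mono mult_mono C c) auto
  qed
  finally have "c * conv \<tau> ?w x \<le> c * ((1 + C) * \<tau> x)"
    by (intro mult_left_mono c) (simp add: algebra_simps)
  moreover have "conv ?w ?w x = ?w x + c * conv \<tau> ?w x"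
    by (simp add: conv_left_add[OF summable_delta c\<tau> summable_on_imp_bounded[OF w]]
        conv_delta_left conv_left_cmult)
  moreover have "0 \<le> (1 + C) * delta x"
    using C0 by (simp add: delta_def)
  ultimately show ?thesis
    by (simp add: algebra_simps)
qed

section \<open>From the inverse to the resolvent equation\<close>

text \<open>If the family defining the normalisation is not summable, then its \<open>infsum\<close> is \<open>0\<close>, and division
  by \<open>0\<close> turns \<open>D\<close> into the zero function.\<close>
lemma summable_D: "(D v L :: int ^ 'n \<Rightarrow> real) summable_on UNIV"
proof (cases "(\<lambda>y :: int ^ 'n. v (embed y /\<^sub>R L)) summable_on UNIV")
  case True
  from summable_on_cmult_left[OF this, of "inverse (D_norm v L)"] show ?thesis
    by (simp add: D_def[abs_def] divide_inverse)
next
  case False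
  then have "D_norm v L = 0"
    unfolding D_norm_def by (rule infsum_not_exists)
  then show ?thesis
    by (simp add: D_def[abs_def])
qed

text \<open>Convolve the equation with \<open>u\<close> and use \<open>u * (E * h) = (u * h) * E = E\<close>.\<close>
lemma resolvent_of_inverse:
  fixes u h E G :: "int ^ 'n \<Rightarrow> real"
  assumes u: "u summable_on UNIV" and h: "h summable_on UNIV" and E: "E summable_on UNIV"
    and inv: "conv u h = delta" and G: "bounded (range G)"
    and eq: "\<And>x. G x = h x + conv (conv E h) G x"
  shows "conv (\<lambda>y. u y - E y) G x = delta x"
proof -
  have Eh: "conv E h summable_on UNIV"
    by (rule summable_conv[OF E h])
  have "conv u (conv (conv E h) G) = conv (conv u (conv h E)) G"
    using conv_assoc[OF u Eh G] by (simp add: conv_commute[of E h])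
  also have "conv u (conv h E) = E"
    using conv_assoc[OF u h summable_on_imp_bounded[OF E]] by (simp add: inv conv_delta_left)
  finally have *: "conv u (conv (conv E h) G) = conv E G" .
  have "G = (\<lambda>x. h x + conv (conv E h) G x)"
    using eq by (rule ext)
  then have "conv u G x = conv u (\<lambda>x. h x + conv (conv E h) G x) x"
    by simp
  also have "\<dots> = conv u h x + conv u (conv (conv E h) G) x"
    using infsum_add[OF summable_conv_terms[OF u summable_on_imp_bounded[OF h], of x]
        summable_conv_terms[OF u bounded_conv[OF Eh G], of x]]
    by (simp add: conv_def distrib_left)
  also have "\<dots> = delta x + conv E G x"
    by (simp add: inv *)
  finally show ?thesis
    by (simp add: conv_left_diff[OF u E G])
qed

theorem proposition1p6:
  fixes v :: "real ^ 'n \<Rightarrow> real"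
    and \<rho> \<epsilon> L0 K_h :: real
    and \<omega> :: "real \<Rightarrow> real"
  assumes "\<rho> > -2" and "0 < \<epsilon>" and "\<epsilon> < 2"
    and "spread_out_profile v"
    and "L0 \<ge> 1" and "\<forall>L\<ge>L0. D_norm v L \<noteq> 0"
    and "\<forall>L\<ge>L0. \<omega> L \<ge> 0" and "(\<omega> \<longlongrightarrow> 0) at_top"
  shows "\<exists>L1 K_\<Phi> \<omega>'. L1 \<ge> L0 \<and> (\<forall>L\<ge>L1. \<omega>' L \<ge> 0) \<and> (\<omega>' \<longlongrightarrow> 0) at_top \<and>
    (\<forall>(I :: real \<Rightarrow> real set) (h :: real \<Rightarrow> real \<Rightarrow> int ^ 'n \<Rightarrow> real).
      (\<forall>L\<ge>L0. I L \<subseteq> {1..}) \<longrightarrow>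
      (\<forall>L\<ge>L0. \<forall>z\<in>I L. Zd_symmetric (h L z)) \<longrightarrow>
      (\<forall>L\<ge>L0. \<forall>z\<in>I L. \<forall>x. \<bar>h L z x - delta x\<bar>
          \<le> K_h * L powr (-2 + \<epsilon>) * (delta x + \<omega> L / tnorm x powr (real CARD('n) + 2 + \<rho>))) \<longrightarrow>
      (\<forall>L\<ge>L1. \<forall>z\<in>I L. \<exists>\<Phi> :: int ^ 'n \<Rightarrow> real.
        Zd_symmetric \<Phi> \<and>
        (\<forall>x. \<bar>\<Phi> x\<bar>
          \<le> K_\<Phi> * L powr (-2 + \<epsilon>) * (delta x + \<omega>' L / tnorm x powr (real CARD('n) + 2 + \<rho>))) \<and>
        (\<forall>G :: int ^ 'n \<Rightarrow> real.
          bounded (range G) \<longrightarrow>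
          (\<forall>x. G x = h L z x + conv (conv (\<lambda>y. z * D v L y) (h L z)) G x) \<longrightarrow>
          (\<forall>x. conv (\<lambda>y. delta y - z * D v L y - \<Phi> y) G x = delta x))))"
proof -
  define a where "a = real CARD('n) + 2 + \<rho>"
  have a: "real CARD('n) < a"
    using assms(1) by (simp add: a_def)
  obtain C where C0: "0 \<le> C"
    and C: "\<And>x :: int ^ 'n. conv (\<lambda>y. tnorm y powr - a) (\<lambda>y. tnorm y powr - a) x
      \<le> C * tnorm x powr - a"
    using conv_tnorm_powr_bound[OF a] by blast
  (* K_h may be negative; the bounds below need a nonnegative factor. *)
  define K where "K = max K_h 0"
  have "((\<lambda>L. K * L powr (-2 + \<epsilon>) * (2 + C)) \<longlongrightarrow> K * 0 * (2 + C)) at_top"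
    using assms(3) by (intro tendsto_intros tendsto_neg_powr filterlim_ident) auto
  then have "\<forall>\<^sub>F L in at_top. K * L powr (-2 + \<epsilon>) * (2 + C) < 1 / 2"
    by (rule order_tendstoD) simp
  moreover have "\<forall>\<^sub>F L in at_top. \<omega> L < 1"
    by (rule order_tendstoD[OF assms(8)]) simp
  ultimately have "\<forall>\<^sub>F L in at_top. L0 \<le> L \<and> \<omega> L < 1 \<and> K * L powr (-2 + \<epsilon>) * (2 + C) < 1 / 2"
    using eventually_ge_at_top[of L0] by eventually_elim simp
  then obtain L1 where L1: "\<And>L. L1 \<le> L \<Longrightarrow>
      L0 \<le> L \<and> \<omega> L < 1 \<and> K * L powr (-2 + \<epsilon>) * (2 + C) < 1 / 2"
    unfolding eventually_at_top_linorder by blast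
  show ?thesis
  proof (rule exI[of _ L1], rule exI[of _ "2 * K"], rule exI[of _ \<omega>], intro conjI allI impI ballI)
    show "L0 \<le> L1" using L1[of L1] by simp
    show "0 \<le> \<omega> L" if "L1 \<le> L" for L using L1[OF that] assms(7) by simp
    show "(\<omega> \<longlongrightarrow> 0) at_top" by (rule assms(8))
  next
    fix I :: "real \<Rightarrow> real set" and h :: "real \<Rightarrow> real \<Rightarrow> int ^ 'n \<Rightarrow> real" and L z
    assume sym: "\<forall>L\<ge>L0. \<forall>z\<in>I L. Zd_symmetric (h L z)"
      and close: "\<forall>L\<ge>L0. \<forall>z\<in>I L. \<forall>x. \<bar>h L z x - delta x\<bar>
          \<le> K_h * L powr (-2 + \<epsilon>) * (delta x + \<omega> L / tnorm x powr (real CARD('n) + 2 + \<rho>))"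
      and L: "L1 \<le> L" and z: "z \<in> I L"
    define \<eta> where "\<eta> = K * L powr (-2 + \<epsilon>)"
    define w where "w = (\<lambda>x :: int ^ 'n. delta x + \<omega> L * tnorm x powr - a)"
    define e where "e = (\<lambda>x. h L z x - delta x)"
    have LL0: "L0 \<le> L" and \<omega>: "0 \<le> \<omega> L" "\<omega> L \<le> 1" and \<eta>: "0 \<le> \<eta>" "\<eta> * (2 + C) \<le> 1 / 2"
      using L1[OF L] assms(7) by (auto simp: \<eta>_def K_def)
    have w_eq: "w x = delta x + \<omega> L / tnorm x powr (real CARD('n) + 2 + \<rho>)" for x
      by (simp only: w_def a_def powr_minus divide_inverse)
    have w0: "0 \<le> w x" for x
      using \<omega> by (simp add: w_def delta_def)
    have ws: "w summable_on UNIV"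
      unfolding w_def
      by (intro summable_on_add summable_delta summable_on_cmult_right summable_on_tnorm_powr a)
    have stable: "conv w w x \<le> (2 + C) * w x" for x
      unfolding w_def
      by (rule conv_weight_bound[OF _ summable_on_tnorm_powr[OF a] C \<omega> C0]) simp
    have e_bound: "\<bar>e x\<bar> \<le> \<eta> * w x" for x
    proof -
      have "\<bar>e x\<bar> \<le> K_h * L powr (-2 + \<epsilon>) * w x"
        unfolding e_def w_eq using close LL0 z by blast
      also have "\<dots> \<le> \<eta> * w x"
        unfolding \<eta>_def K_def by (intro mult_right_mono w0) auto
      finally show ?thesis .
    qed
    have e_sym: "Zd_symmetric e"
      using sym LL0 z Zd_symmetric_delta by (simp add: Zd_symmetric_def e_def)
    obtain \<Phi> where \<Phi>_sym: "Zd_symmetric \<Phi>" and \<Phi>_bound: "\<And>x. \<bar>\<Phi> x\<bar> \<le> 2 * \<eta> * w x"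
      and inv: "conv (\<lambda>y. delta y - \<Phi> y) (\<lambda>y. delta y + e y) = delta"
      using neumann_inverse[OF w0 ws stable \<eta> _ e_bound e_sym] C0 by auto
    have h_eq: "(\<lambda>y. delta y + e y) = h L z"
      by (simp add: e_def)
    have "\<Phi> summable_on UNIV" and "e summable_on UNIV"
      by (rule summable_on_dominated[OF summable_on_cmult_right[OF ws]], rule \<Phi>_bound e_bound)+
    then have us: "(\<lambda>y. delta y - \<Phi> y) summable_on UNIV" and hs: "h L z summable_on UNIV"
      using summable_on_add[OF summable_delta summable_on_cmult_right[of \<Phi> UNIV "- 1"]]
        summable_on_add[OF summable_delta, of e] by (simp_all add: h_eq)
    show "\<exists>\<Phi> :: int ^ 'n \<Rightarrow> real. Zd_symmetric \<Phi> \<and>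
        (\<forall>x. \<bar>\<Phi> x\<bar> \<le> 2 * K * L powr (-2 + \<epsilon>)
            * (delta x + \<omega> L / tnorm x powr (real CARD('n) + 2 + \<rho>))) \<and>
        (\<forall>G :: int ^ 'n \<Rightarrow> real.
          bounded (range G) \<longrightarrow>
          (\<forall>x. G x = h L z x + conv (conv (\<lambda>y. z * D v L y) (h L z)) G x) \<longrightarrow>
          (\<forall>x. conv (\<lambda>y. delta y - z * D v L y - \<Phi> y) G x = delta x))"
    proof (intro exI[of _ \<Phi>] conjI allI impI)
      show "\<bar>\<Phi> x\<bar> \<le> 2 * K * L powr (-2 + \<epsilon>)
          * (delta x + \<omega> L / tnorm x powr (real CARD('n) + 2 + \<rho>))" for x
        using \<Phi>_bound[of x] by (simp add: w_eq \<eta>_def mult.assoc)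
    next
      fix G :: "int ^ 'n \<Rightarrow> real" and x
      assume G: "bounded (range G)"
        and eq: "\<forall>x. G x = h L z x + conv (conv (\<lambda>y. z * D v L y) (h L z)) G x"
      have "conv (\<lambda>y. (delta y - \<Phi> y) - z * D v L y) G x = delta x"
        using us hs inv G eq
        by (intro resolvent_of_inverse[of _ "h L z"] summable_on_cmult_right summable_D)
          (simp_all add: h_eq)
      then show "conv (\<lambda>y. delta y - z * D v L y - \<Phi> y) G x = delta x"
        by (simp add: algebra_simps)
    qed (rule \<Phi>_sym)
  qed
qed

end
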